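(* Let $n>3$. For Wolfram rules $1$, $9$, $129$ and $137$ on the circular graph with $n$ vertices, the sets of periodic states are $P_1=P_9=N_A$ and $P_{129}=P_{137}=N_A\cup\{\mathbf{1}\}$; the numbers of orbits of the dynamics groups $G_k$ on $P_k$ are $o_1=o_9=1$ and $o_{129}=o_{137}=2$; and the groups $G_1$, $G_9$, $G_{129}$ and $G_{137}$ are all isomorphic to the Lucas group $\mathrm{LG}_n$.
   Context: Indices are taken modulo $n$. For $0\le k\le 255$ write $k=\sum_{j=0}^7 a_j2^j$ with $a_j\in\{0,1\}$ and let $f_k(a,b,c)=a_{4a+2b+c}$ for $a,b,c\in\{0,1\}$. The local update function $F_i^{(k)}$ of Wolfram rule $k$ is the map $\mathbb{F}_2^n\to\mathbb{F}_2^n$ replacing $y_i$ by $f_k(y_{i-1},y_i,y_{i+1})$ and leaving all other coordinates unchanged. Rules $1,9,129,137$ are $\pi$-independent: for a simple update order $\pi$ (a sequence $\pi_1,\dots,\pi_n$ containing each of $1,\dots,n$ exactly once) the set of states periodic under iteration of $F_{\pi_n}^{(k)}\circ\cdots\circ F_{\pi_1}^{(k)}$ does not depend on $\pi$; this set is $P_k$. The dynamics group $G_k$ is the group of permutations of $P_k$ generated by the restrictions of $F_1^{(k)},\dots,F_n^{(k)}$ to $P_k$. $\mathbf{1}$ is the all-$1$ state, and $N_A$ is the set of states in $\mathbb{F}_2^n$ with no two cyclically adjacent $1$s. The Lucas group $\mathrm{LG}_n$ is defined using Wolfram rule $201$, whose local function $F_i^{(201)}$ changes $y_i$ to $1-y_i$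 if $y_{i-1}=y_{i+1}=0$ and otherwise fixes $\mathbf{y}$; these are bijections of $\mathbb{F}_2^n$ generating a permutation group $G_{201}$, and $\mathrm{LG}_n$ is the permutation group obtained by restricting $G_{201}$ to the orbit of the all-zero state (this orbit is $N_A$). *)

theory Defs
  imports "HOL-Library.Z2" "HOL-Library.FuncSet" "HOL-Algebra.Algebra"
begin

text \<open>
  The vertices of the circular graph are \<open>0, \<dots>, n - 1\<close>, read modulo \<open>n\<close>, and
  \<open>bit\<close> is the field with two elements.  A state is an extensional function, so
  that states which agree on the vertices are equal.
\<close>

definition states :: "nat \<Rightarrow> (nat \<Rightarrow> bit) set" where
  "states n = {..<n} \<rightarrow>\<^sub>E UNIV"

definition next_vertex :: "nat \<Rightarrow> nat \<Rightarrow> nat" where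
  "next_vertex n i = (i + 1) mod n"

definition prev_vertex :: "nat \<Rightarrow> nat \<Rightarrow> nat" where
  "prev_vertex n i = (i + n - 1) mod n"

definition zero_state :: "nat \<Rightarrow> nat \<Rightarrow> bit" where
  "zero_state n = (\<lambda>i\<in>{..<n}. 0)"

definition one_state :: "nat \<Rightarrow> nat \<Rightarrow> bit" where
  "one_state n = (\<lambda>i\<in>{..<n}. 1)"

definition no_adjacent_ones :: "nat \<Rightarrow> (nat \<Rightarrow> bit) set" where
  "no_adjacent_ones n =
     {y \<in> states n. \<forall>i<n. \<not> (y i = 1 \<and> y (next_vertex n i) = 1)}"

text \<open>The value is the binary digit of \<open>k\<close> at position \<open>4 a + 2 b + c\<close>.\<close>

definition wolfram :: "nat \<Rightarrow> bit \<Rightarrow> bit \<Rightarrow> bit \<Rightarrow> bit" where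
  "wolfram k a b c =
     of_bool (Bit_Operations.bit k (4 * of_bit a + 2 * of_bit b + of_bit c))"

definition local_update :: "nat \<Rightarrow> nat \<Rightarrow> nat \<Rightarrow> (nat \<Rightarrow> bit) \<Rightarrow> (nat \<Rightarrow> bit)" where
  "local_update n k i y =
     y(i := wolfram k (y (prev_vertex n i)) (y i) (y (next_vertex n i)))"

definition simple_update_order :: "nat \<Rightarrow> nat list \<Rightarrow> bool" where
  "simple_update_order n \<pi> \<longleftrightarrow> distinct \<pi> \<and> set \<pi> = {..<n}"

text \<open>\<open>fold\<close> applies the local update of the first vertex in \<open>\<pi>\<close> first.\<close>

definition system_update :: "nat \<Rightarrow> nat \<Rightarrow> nat list \<Rightarrow> (nat \<Rightarrow> bit) \<Rightarrow> (nat \<Rightarrow> bit)" where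
  "system_update n k \<pi> = fold (local_update n k) \<pi>"

definition periodic_states :: "nat \<Rightarrow> nat \<Rightarrow> nat list \<Rightarrow> (nat \<Rightarrow> bit) set" where
  "periodic_states n k \<pi> =
     {y \<in> states n. \<exists>m>0. (system_update n k \<pi> ^^ m) y = y}"

text \<open>
  The group of permutations of \<open>S\<close> generated by the restrictions to \<open>S\<close> of the
  maps in \<open>A\<close>.  It is meaningful when each of these maps permutes \<open>S\<close>.
\<close>

definition permutation_group_on :: "'a set \<Rightarrow> ('a \<Rightarrow> 'a) set \<Rightarrow> ('a \<Rightarrow> 'a) monoid" where
  "permutation_group_on S A =
     (BijGroup S)\<lparr>carrier := generate (BijGroup S) ((\<lambda>f. restrict f S) ` A)\<rparr>"

lemma group_permutation_group_on:
  assumes "\<And>f. f \<in> A \<Longrightarrow> bij_betw f S S"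
  shows "group (permutation_group_on S A)"
proof -
  interpret group "BijGroup S" by (rule group_BijGroup)
  have "(\<lambda>f. restrict f S) ` A \<subseteq> carrier (BijGroup S)"
    using assms by (auto simp: BijGroup_def Bij_def)
  then show ?thesis
    unfolding permutation_group_on_def
    by (intro subgroup.subgroup_is_group generate_is_subgroup is_group)
qed

text \<open>
  For a rule that is independent of the update order, the set of periodic states,
  and with it the dynamics group, is the same for all simple update orders \<open>\<pi>\<close>.
\<close>

definition dynamics_group ::
    "nat \<Rightarrow> nat \<Rightarrow> nat list \<Rightarrow> ((nat \<Rightarrow> bit) \<Rightarrow> (nat \<Rightarrow> bit)) monoid" where
  "dynamics_group n k \<pi> =
     permutation_group_on (periodic_states n k \<pi>) (local_update n k ` {..<n})"

definition number_of_orbits :: "nat \<Rightarrow> nat \<Rightarrow> nat list \<Rightarrow> nat" where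
  "number_of_orbits n k \<pi> =
     card (orbits (dynamics_group n k \<pi>) (periodic_states n k \<pi>) (\<lambda>g. g))"

definition G201 :: "nat \<Rightarrow> ((nat \<Rightarrow> bit) \<Rightarrow> (nat \<Rightarrow> bit)) monoid" where
  "G201 n = permutation_group_on (states n) (local_update n 201 ` {..<n})"

definition zero_orbit :: "nat \<Rightarrow> (nat \<Rightarrow> bit) set" where
  "zero_orbit n = orbit (G201 n) (\<lambda>g. g) (zero_state n)"

definition Lucas_group :: "nat \<Rightarrow> ((nat \<Rightarrow> bit) \<Rightarrow> (nat \<Rightarrow> bit)) monoid" where
  "Lucas_group n =
     (BijGroup (zero_orbit n))
       \<lparr>carrier := (\<lambda>g. restrict g (zero_orbit n)) ` carrier (G201 n)\<rparr>"

text \<open>Rule 201 flips a vertex exactly when both of its neighbours are zero.\<close>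

lemma wolfram_201: "wolfram 201 a b c = (if a = 0 \<and> c = 0 then 1 - b else b)"
  by (cases a; cases b; cases c) (simp_all add: wolfram_def bit_iff_odd)

end

theory Submission
  imports Defs
begin

text \<open>
  Around a vertex of a state without adjacent ones only the neighbourhoods \<open>a0c\<close> and
  \<open>010\<close> occur.  On these the rules 1, 9, 129 and 137 do the same as rule 201: the vertex
  is flipped if both neighbours are zero and kept otherwise.  So on
  \<^term>\<open>no_adjacent_ones n\<close> the five rules have the same local updates
  (\<open>local_update_eq_201\<close>), which are involutions there and generate one and the same
  group.  This group is transitive, since switching off the ones of a state in
  any order leads to the zero state (\<open>closed_subset_no_adjacent_ones\<close>).

  What remains is to see which other states are periodic.  None of the rules creates a
  pair of adjacent ones, so along a periodic trajectory the set of such pairs is constant.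
  But the four rules send \<open>110\<close> to \<open>0\<close>, so a block of at least two ones
  loses its last one when the sweep gets there (\<open>adjacent_ones_next\<close>).  The only
  state with pairs that has no such end of a block is the all-one state; it is fixed if
  the rule sends \<open>111\<close> to \<open>1\<close>, as 129 and 137 do, and is not periodic
  otherwise (\<open>periodic_states_eq\<close>).

  For rules 1 and 9 the dynamics group is therefore literally the Lucas group.  For
  rules 129 and 137 it has one further orbit, a fixed point, and dropping a fixed point
  does not change a permutation group up to isomorphism
  (\<open>permutation_group_on_iso_restrict\<close>).
\<close>

section \<open>Permutation groups and invariant subsets\<close>

abbreviation stabilizer_in_Bij :: "'a set \<Rightarrow> 'a set \<Rightarrow> ('a \<Rightarrow> 'a) set" where
  "stabilizer_in_Bij S T \<equiv> {g \<in> Bij S. bij_betw g T T}"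

lemma subgroup_stabilizer_in_Bij:
  assumes "T \<subseteq> S"
  shows "subgroup (stabilizer_in_Bij S T) (BijGroup S)"
proof (rule group.subgroupI[OF group_BijGroup])
  show "stabilizer_in_Bij S T \<subseteq> carrier (BijGroup S)"
    by (auto simp: BijGroup_def)
  have "bij_betw (\<lambda>x\<in>S. x) T T"
    using assms by (auto simp: bij_betw_def inj_on_def)
  then show "stabilizer_in_Bij S T \<noteq> {}"
    using id_Bij by auto
next
  fix g assume g: "g \<in> stabilizer_in_Bij S T"
  have "bij_betw (inv_into S g) T T"
    using g assms by (intro bij_betw_inv_into_subset[of g S S]) (auto simp: Bij_def bij_betw_def)
  then have "bij_betw (\<lambda>x\<in>S. inv_into S g x) T T"
    using assms by (subst bij_betw_cong[of T _ "inv_into S g"]) auto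
  then show "inv\<^bsub>BijGroup S\<^esub> g \<in> stabilizer_in_Bij S T"
    using g by (simp add: inv_BijGroup restrict_inv_into_Bij)
next
  fix g h assume g: "g \<in> stabilizer_in_Bij S T" and h: "h \<in> stabilizer_in_Bij S T"
  have "bij_betw (g \<circ> h) T T"
    using g h by (auto intro: bij_betw_trans)
  then have "bij_betw (compose S g h) T T"
    using assms by (subst bij_betw_cong[of T _ "g \<circ> h"]) (auto simp: compose_def)
  then show "g \<otimes>\<^bsub>BijGroup S\<^esub> h \<in> stabilizer_in_Bij S T"
    using g h by (simp add: BijGroup_def compose_Bij)
qed

text \<open>
  Restriction to \<open>T\<close> respects composition only for permutations that preserve \<open>T\<close>, hence
  the passage to the setwise stabilizer.
\<close>

lemma restriction_group_hom:
  assumes "T \<subseteq> S"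
  shows "group_hom ((BijGroup S)\<lparr>carrier := stabilizer_in_Bij S T\<rparr>) (BijGroup T)
           (\<lambda>g. restrict g T)"
proof -
  have G: "group ((BijGroup S)\<lparr>carrier := stabilizer_in_Bij S T\<rparr>)"
    using group.subgroup_imp_group[OF group_BijGroup subgroup_stabilizer_in_Bij[OF assms]] .
  have restrict_Bij: "restrict g T \<in> Bij T" if "g \<in> stabilizer_in_Bij S T" for g
    using that by (auto simp: Bij_def)
  have "restrict (compose S g h) T = compose T (restrict g T) (restrict h T)"
    if "h \<in> stabilizer_in_Bij S T" for g h
    using that assms by (auto simp: compose_def restrict_def fun_eq_iff bij_betw_def)
  with restrict_Bij have "(\<lambda>g. restrict g T)
      \<in> hom ((BijGroup S)\<lparr>carrier := stabilizer_in_Bij S T\<rparr>) (BijGroup T)"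
    by (intro homI) (auto simp: BijGroup_def)
  with G show ?thesis
    by (simp add: group_hom_def group_hom_axioms_def group_BijGroup)
qed

lemma carrier_permutation_group_on_subset:
  assumes "T \<subseteq> S"
    and "\<And>f. f \<in> A \<Longrightarrow> bij_betw f S S" and "\<And>f. f \<in> A \<Longrightarrow> bij_betw f T T"
  shows "(\<lambda>f. restrict f S) ` A \<subseteq> stabilizer_in_Bij S T"
    and "carrier (permutation_group_on S A) \<subseteq> stabilizer_in_Bij S T"
proof -
  have "bij_betw (restrict f S) T T" if "f \<in> A" for f
    using assms(1) assms(3)[OF that] by (subst bij_betw_cong[of T _ f]) auto
  then show gens: "(\<lambda>f. restrict f S) ` A \<subseteq> stabilizer_in_Bij S T"
    using assms(2) by (auto simp: Bij_def)
  show "carrier (permutation_group_on S A) \<subseteq> stabilizer_in_Bij S T"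
    using group.generate_subgroup_incl[OF group_BijGroup gens subgroup_stabilizer_in_Bij[OF assms(1)]]
    by (simp add: permutation_group_on_def)
qed

text \<open>
  The homomorphic image of a generated subgroup is generated by the images of the
  generators.  This connects the Lucas group, which consists of restrictions of
  permutations of all states, with groups generated by restricted local updates.
\<close>

lemma carrier_permutation_group_on_restrict:
  assumes "T \<subseteq> S"
    and "\<And>f. f \<in> A \<Longrightarrow> bij_betw f S S" and "\<And>f. f \<in> A \<Longrightarrow> bij_betw f T T"
  shows "(\<lambda>g. restrict g T) ` carrier (permutation_group_on S A)
           = carrier (permutation_group_on T A)"
proof -
  interpret restriction: group_hom
    "(BijGroup S)\<lparr>carrier := stabilizer_in_Bij S T\<rparr>" "BijGroup T" "\<lambda>g. restrict g T"
    by (rule restriction_group_hom[OF assms(1)])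
  have gens: "(\<lambda>f. restrict f S) ` A \<subseteq> stabilizer_in_Bij S T"
    using carrier_permutation_group_on_subset(1)[OF assms] .
  have "generate (BijGroup T) ((\<lambda>g. restrict g T) ` (\<lambda>f. restrict f S) ` A)
      = (\<lambda>g. restrict g T) ` generate (BijGroup S) ((\<lambda>f. restrict f S) ` A)"
    using restriction.generate_img[of "(\<lambda>f. restrict f S) ` A"] gens
      group.generate_consistent[OF group_BijGroup gens subgroup_stabilizer_in_Bij[OF assms(1)]]
    by simp
  moreover have "(\<lambda>g. restrict g T) ` (\<lambda>f. restrict f S) ` A = (\<lambda>f. restrict f T) ` A"
    using assms(1) by (simp add: image_image Int_absorb1)
  ultimately show ?thesis
    by (simp add: permutation_group_on_def)
qed

text \<open>
  A permutation that fixes everything outside \<open>T\<close> is determined by its restriction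
  to \<open>T\<close>.  That the whole group fixes a point which its generators fix is invariance
  of a singleton.
\<close>

lemma permutation_group_on_iso_restrict:
  assumes "T \<subseteq> S"
    and "\<And>f. f \<in> A \<Longrightarrow> bij_betw f S S" and "\<And>f. f \<in> A \<Longrightarrow> bij_betw f T T"
    and fixed: "\<And>f x. f \<in> A \<Longrightarrow> x \<in> S - T \<Longrightarrow> f x = x"
  shows "permutation_group_on S A \<cong> permutation_group_on T A"
proof (rule is_isoI, rule isoI)
  note sub = carrier_permutation_group_on_subset(2)[OF assms(1-3)]
  note onto = carrier_permutation_group_on_restrict[OF assms(1-3)]
  interpret restriction: group_hom
    "(BijGroup S)\<lparr>carrier := stabilizer_in_Bij S T\<rparr>" "BijGroup T" "\<lambda>g. restrict g T"
    by (rule restriction_group_hom[OF assms(1)])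
  show "(\<lambda>g. restrict g T) \<in> hom (permutation_group_on S A) (permutation_group_on T A)"
  proof (rule homI)
    fix g h
    assume g: "g \<in> carrier (permutation_group_on S A)"
      and h: "h \<in> carrier (permutation_group_on S A)"
    show "restrict g T \<in> carrier (permutation_group_on T A)"
      using g onto by blast
    show "restrict (g \<otimes>\<^bsub>permutation_group_on S A\<^esub> h) T
        = restrict g T \<otimes>\<^bsub>permutation_group_on T A\<^esub> restrict h T"
      using restriction.hom_mult[of g h] subsetD[OF sub g] subsetD[OF sub h]
      by (simp add: permutation_group_on_def)
  qed
  have fix_outside: "g x = x" if g: "g \<in> carrier (permutation_group_on S A)" and x: "x \<in> S - T" for g x
  proof -
    have "bij_betw f {x} {x}" if "f \<in> A" for f
      using fixed[OF that x] by (simp add: bij_betw_def)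
    then have "g \<in> stabilizer_in_Bij S {x}"
      using carrier_permutation_group_on_subset(2)[of "{x}" S A] g x assms(2) by blast
    then show ?thesis
      by (simp add: bij_betw_def)
  qed
  have "inj_on (\<lambda>g. restrict g T) (carrier (permutation_group_on S A))"
  proof (rule inj_onI)
    fix g h
    assume g: "g \<in> carrier (permutation_group_on S A)"
      and h: "h \<in> carrier (permutation_group_on S A)"
      and eq: "restrict g T = restrict h T"
    show "g = h"
    proof (rule extensionalityI)
      show "g \<in> extensional S" "h \<in> extensional S"
        using subsetD[OF sub g] subsetD[OF sub h] by (auto simp: Bij_def)
      show "g x = h x" if "x \<in> S" for x
        using fix_outside[OF g, of x] fix_outside[OF h, of x] fun_cong[OF eq, of x] that
        by (cases "x \<in> T") auto
    qed
  qed
  with onto show "bij_betw (\<lambda>g. restrict g T)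
      (carrier (permutation_group_on S A)) (carrier (permutation_group_on T A))"
    by (simp add: bij_betw_def)
qed

lemma permutation_group_on_cong:
  assumes "\<And>i x. i \<in> I \<Longrightarrow> x \<in> S \<Longrightarrow> F i x = F' i x"
  shows "permutation_group_on S (F ` I) = permutation_group_on S (F' ` I)"
proof -
  have "restrict (F i) S = restrict (F' i) S" if "i \<in> I" for i
    using assms that by auto
  then show ?thesis
    by (simp add: permutation_group_on_def image_image)
qed

lemma orbit_permutation_group_on_subset:
  assumes "T \<subseteq> S" and "x \<in> T"
    and "\<And>f. f \<in> A \<Longrightarrow> bij_betw f S S" and "\<And>f. f \<in> A \<Longrightarrow> bij_betw f T T"
  shows "orbit (permutation_group_on S A) (\<lambda>g. g) x \<subseteq> T"
  using carrier_permutation_group_on_subset(2)[OF assms(1,3,4)] assms(2)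
  by (auto simp: orbit_def bij_betw_def)

lemma orbit_permutation_group_on_refl:
  assumes "x \<in> S"
  shows "x \<in> orbit (permutation_group_on S A) (\<lambda>g. g) x"
proof -
  have "(\<lambda>x\<in>S. x) \<in> carrier (permutation_group_on S A)"
    using generate.one[of "BijGroup S"] by (simp add: permutation_group_on_def BijGroup_def)
  with assms show ?thesis
    unfolding orbit_def by (intro CollectI exI[of _ "\<lambda>x\<in>S. x"]) simp
qed

lemma orbit_permutation_group_on_step:
  assumes bij: "\<And>f. f \<in> A \<Longrightarrow> bij_betw f S S" and x: "x \<in> S" and f: "f \<in> A"
    and y: "y \<in> orbit (permutation_group_on S A) (\<lambda>g. g) x"
  shows "f y \<in> orbit (permutation_group_on S A) (\<lambda>g. g) x"
proof -
  obtain g where g: "g \<in> carrier (permutation_group_on S A)" and gx: "y = g x"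
    using y by (auto simp: orbit_def)
  have gB: "g \<in> Bij S"
    using carrier_permutation_group_on_subset(2)[of S S A] bij g by blast
  have fB: "restrict f S \<in> Bij S"
    using bij[OF f] by (simp add: Bij_def)
  have "restrict f S \<otimes>\<^bsub>BijGroup S\<^esub> g \<in> carrier (permutation_group_on S A)"
    using g f by (auto simp: permutation_group_on_def intro: generate.eng generate.incl)
  then have "compose S (restrict f S) g \<in> carrier (permutation_group_on S A)"
    using gB fB by (simp add: BijGroup_def)
  moreover have "compose S (restrict f S) g x = f y"
    using x gB gx by (auto simp: compose_def Bij_def bij_betw_def)
  ultimately show ?thesis
    unfolding orbit_def by (intro CollectI exI[of _ "compose S (restrict f S) g"]) simp
qed


section \<open>Local updates on states without adjacent ones\<close>

text \<open>
  The two conditions describe what a rule does around a vertex of a state without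
  adjacent ones, where the neighbourhoods \<open>110\<close>, \<open>011\<close> and \<open>111\<close> do not occur.
\<close>

definition agrees_with_201 :: "nat \<Rightarrow> bool" where
  "agrees_with_201 k \<longleftrightarrow>
     (\<forall>a c. wolfram k a 0 c = of_bool (a = 0 \<and> c = 0)) \<and> wolfram k 0 1 0 = 0"

lemma agrees_with_201_rules:
  assumes "k \<in> {1, 9, 129, 137, 201}"
  shows "agrees_with_201 k"
proof -
  have "wolfram k a 0 c = of_bool (a = 0 \<and> c = 0)" for a c
    using assms by (cases a; cases c) (auto simp: wolfram_def bit_iff_odd)
  moreover have "wolfram k 0 1 0 = 0"
    using assms by (auto simp: wolfram_def bit_iff_odd)
  ultimately show ?thesis
    by (simp add: agrees_with_201_def)
qed

lemma wolfram_110: "k \<in> {1, 9, 129, 137} \<Longrightarrow> wolfram k 1 1 0 = 0"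
  by (auto simp: wolfram_def bit_iff_odd)

lemma wolfram_111:
  "wolfram 1 1 1 1 = 0" "wolfram 9 1 1 1 = 0" "wolfram 129 1 1 1 = 1" "wolfram 137 1 1 1 = 1"
  by (simp_all add: wolfram_def bit_iff_odd)

lemma bit_cases: "(b :: bit) = 0 \<or> b = 1"
  by (cases b) auto

lemma next_vertex_less: "0 < n \<Longrightarrow> next_vertex n i < n"
  by (simp add: next_vertex_def)

lemma prev_vertex_less: "0 < n \<Longrightarrow> prev_vertex n i < n"
  by (simp add: prev_vertex_def)

lemma next_vertex_prev_vertex: "i < n \<Longrightarrow> next_vertex n (prev_vertex n i) = i"
  by (cases i) (auto simp: next_vertex_def prev_vertex_def mod_Suc)

lemma prev_vertex_next_vertex: "i < n \<Longrightarrow> prev_vertex n (next_vertex n i) = i"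
  by (cases "Suc i = n") (auto simp: next_vertex_def prev_vertex_def)

lemma next_vertex_neq: "1 < n \<Longrightarrow> i < n \<Longrightarrow> next_vertex n i \<noteq> i"
  by (cases "Suc i = n") (auto simp: next_vertex_def)

lemma prev_vertex_neq: "1 < n \<Longrightarrow> i < n \<Longrightarrow> prev_vertex n i \<noteq> i"
  by (metis next_vertex_neq next_vertex_prev_vertex)

lemma finite_states: "finite (states n)"
proof -
  have "(UNIV :: bit set) = {0, 1}"
    using bit_cases by auto
  then have "finite (UNIV :: bit set)"
    by (metis finite.emptyI finite.insertI)
  then show ?thesis
    unfolding states_def by (intro finite_PiE) auto
qed

lemma fun_upd_states: "y \<in> states n \<Longrightarrow> i < n \<Longrightarrow> y(i := b) \<in> states n"
  by (auto simp: states_def PiE_def extensional_def)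

lemma local_update_states: "y \<in> states n \<Longrightarrow> i < n \<Longrightarrow> local_update n k i y \<in> states n"
  by (simp add: local_update_def fun_upd_states)

lemma zero_state_no_adjacent_ones: "zero_state n \<in> no_adjacent_ones n"
  by (auto simp: zero_state_def no_adjacent_ones_def states_def)

lemma no_adjacent_ones_subset: "no_adjacent_ones n \<subseteq> states n"
  by (auto simp: no_adjacent_ones_def)

lemma one_state_states: "one_state n \<in> states n"
  by (auto simp: one_state_def states_def)

lemma one_state_notin_no_adjacent_ones:
  assumes "0 < n"
  shows "one_state n \<notin> no_adjacent_ones n"
proof
  assume "one_state n \<in> no_adjacent_ones n"
  then have "\<not> (one_state n 0 = 1 \<and> one_state n (next_vertex n 0) = 1)"
    using assms by (simp add: no_adjacent_ones_def)
  then show False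
    using assms next_vertex_less[OF assms, of 0] by (simp add: one_state_def)
qed

lemma no_adjacent_ones_neighbours:
  assumes "y \<in> no_adjacent_ones n" "i < n" "y i = 1"
  shows "y (prev_vertex n i) = 0" "y (next_vertex n i) = 0"
proof -
  have apart: "\<not> (y j = 1 \<and> y (next_vertex n j) = 1)" if "j < n" for j
    using assms(1) that by (simp add: no_adjacent_ones_def)
  have "prev_vertex n i < n" using assms(2) by (simp add: prev_vertex_less)
  then show "y (prev_vertex n i) = 0"
    using apart[of "prev_vertex n i"] assms(3) bit_cases[of "y (prev_vertex n i)"]
      next_vertex_prev_vertex[OF assms(2)] by simp
  show "y (next_vertex n i) = 0"
    using apart[OF assms(2)] assms(3) bit_cases[of "y (next_vertex n i)"] by simp
qed

lemma local_update_201: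
  "local_update n 201 i y =
     (if y (prev_vertex n i) = 0 \<and> y (next_vertex n i) = 0 then y(i := 1 - y i) else y)"
  by (auto simp: local_update_def wolfram_201)

lemma local_update_eq_201:
  assumes "agrees_with_201 k" "y \<in> no_adjacent_ones n" "i < n"
  shows "local_update n k i y = local_update n 201 i y"
  using assms no_adjacent_ones_neighbours[OF assms(2,3)] bit_cases[of "y i"]
  by (auto simp: local_update_def agrees_with_201_def wolfram_201)

lemma local_update_201_involution:
  assumes "1 < n" "i < n"
  shows "local_update n 201 i (local_update n 201 i y) = y"
  using next_vertex_neq[OF assms] prev_vertex_neq[OF assms] bit_cases[of "y i"]
  by (auto simp: local_update_201)

lemma local_update_no_adjacent_ones:
  assumes "agrees_with_201 k" "y \<in> no_adjacent_ones n" "1 < n" "i < n"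
  shows "local_update n k i y \<in> no_adjacent_ones n"
proof (cases "y (prev_vertex n i) = 0 \<and> y (next_vertex n i) = 0")
  case True
  have "\<not> ((y(i := b)) j = 1 \<and> (y(i := b)) (next_vertex n j) = 1)" if "j < n" for j b
    using assms(2) that True prev_vertex_next_vertex[OF that] next_vertex_neq[OF assms(3) that]
    by (auto simp: no_adjacent_ones_def)
  then have "y(i := 1 - y i) \<in> no_adjacent_ones n"
    using fun_upd_states[of y n i] assms(2,4) by (auto simp: no_adjacent_ones_def)
  with True show ?thesis
    using local_update_eq_201[OF assms(1,2,4)] by (simp add: local_update_201)
next
  case False
  then show ?thesis
    using local_update_eq_201[OF assms(1,2,4)] assms(2) by (auto simp: local_update_201)
qed

lemma bij_betw_local_update_201_states:
  assumes "1 < n" "i < n"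
  shows "bij_betw (local_update n 201 i) (states n) (states n)"
  by (rule bij_betw_byWitness[where f' = "local_update n 201 i"])
     (use assms in \<open>auto simp: local_update_201_involution local_update_states\<close>)

lemma local_update_involution:
  assumes "agrees_with_201 k" "y \<in> no_adjacent_ones n" "1 < n" "i < n"
  shows "local_update n k i (local_update n k i y) = y"
  using local_update_201_involution[OF assms(3,4)] local_update_no_adjacent_ones[OF assms]
  by (simp add: local_update_eq_201[OF assms(1) _ assms(4)] assms(2))

lemma bij_betw_local_update:
  assumes "agrees_with_201 k" "1 < n" "i < n"
  shows "bij_betw (local_update n k i) (no_adjacent_ones n) (no_adjacent_ones n)"
  by (rule bij_betw_byWitness[where f' = "local_update n k i"])
     (use assms in \<open>auto simp: local_update_no_adjacent_ones local_update_involution\<close>)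

text \<open>
  In a state without adjacent ones every one can be switched off and, the updates being
  involutions, switched on again.  So deleting ones neither enters nor leaves \<open>C\<close>, and
  every state belongs to \<open>C\<close> exactly if the zero state does.  As orbits are closed under the
  generators, this shows transitivity whatever the ambient set of states is.
\<close>

lemma closed_subset_no_adjacent_ones:
  assumes k: "agrees_with_201 k" and n: "1 < n"
    and C: "C \<subseteq> no_adjacent_ones n" "C \<noteq> {}"
    and closed: "\<And>i y. i < n \<Longrightarrow> y \<in> C \<Longrightarrow> local_update n k i y \<in> C"
  shows "C = no_adjacent_ones n"
proof -
  have step: "y(i := 0) \<in> no_adjacent_ones n \<and> (y(i := 0) \<in> C \<longleftrightarrow> y \<in> C)"
    if y: "y \<in> no_adjacent_ones n" and i: "i < n" "y i = 1" for y i
  proof -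
    have eq: "local_update n k i y = y(i := 0)"
      using local_update_eq_201[OF k y i(1)] no_adjacent_ones_neighbours[OF y i] i
      by (simp add: local_update_201)
    have mem: "y(i := 0) \<in> no_adjacent_ones n"
      using local_update_no_adjacent_ones[OF k y n i(1)] eq by simp
    have "local_update n k i (y(i := 0)) = y"
      using local_update_involution[OF k y n i(1)] eq by simp
    with eq mem closed[OF i(1)] show ?thesis
      by metis
  qed
  have "y \<in> C \<longleftrightarrow> zero_state n \<in> C" if "y \<in> no_adjacent_ones n" for y
    using that
  proof (induction "card {i. i < n \<and> y i = 1}" arbitrary: y rule: less_induct)
    case less
    show ?case
    proof (cases "\<exists>i<n. y i = 1")
      case True
      then obtain i where i: "i < n" "y i = 1" by blast
      have "{j. j < n \<and> (y(i := 0)) j = 1} \<subset> {j. j < n \<and> y j = 1}"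
        using i by auto
      then have "card {j. j < n \<and> (y(i := 0)) j = 1} < card {j. j < n \<and> y j = 1}"
        by (intro psubset_card_mono) auto
      then show ?thesis
        using less.hyps[of "y(i := 0)"] step[OF less.prems i] by blast
    next
      case False
      then have "y = zero_state n"
        using less.prems bit_cases
        by (intro extensionalityI[of _ "{..<n}"])
           (auto simp: no_adjacent_ones_def states_def zero_state_def PiE_def)
      then show ?thesis by simp
    qed
  qed
  with C show ?thesis
    by blast
qed

lemma orbit_eq_no_adjacent_ones:
  assumes k: "agrees_with_201 k" and n: "1 < n"
    and S: "no_adjacent_ones n \<subseteq> S" and x: "x \<in> no_adjacent_ones n"
    and bij: "\<And>i. i < n \<Longrightarrow> bij_betw (local_update n k i) S S"
  shows "orbit (permutation_group_on S (local_update n k ` {..<n})) (\<lambda>g. g) x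
           = no_adjacent_ones n"
proof (rule closed_subset_no_adjacent_ones[OF k n])
  let ?A = "local_update n k ` {..<n}"
  have bijS: "bij_betw f S S" if "f \<in> ?A" for f
    using that bij by auto
  have bijN: "bij_betw f (no_adjacent_ones n) (no_adjacent_ones n)" if "f \<in> ?A" for f
    using that bij_betw_local_update[OF k n] by auto
  have "x \<in> S" using S x by blast
  show "orbit (permutation_group_on S ?A) (\<lambda>g. g) x \<subseteq> no_adjacent_ones n"
    by (rule orbit_permutation_group_on_subset[OF S x bijS bijN])
  show "orbit (permutation_group_on S ?A) (\<lambda>g. g) x \<noteq> {}"
    using orbit_permutation_group_on_refl[OF \<open>x \<in> S\<close>] by blast
  show "local_update n k i y \<in> orbit (permutation_group_on S ?A) (\<lambda>g. g) x"
    if "i < n" "y \<in> orbit (permutation_group_on S ?A) (\<lambda>g. g) x" for i y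
    using orbit_permutation_group_on_step[OF bijS \<open>x \<in> S\<close> _ that(2)] that(1) by blast
qed

lemma zero_orbit_eq: "1 < n \<Longrightarrow> zero_orbit n = no_adjacent_ones n"
  unfolding zero_orbit_def G201_def
  by (intro orbit_eq_no_adjacent_ones agrees_with_201_rules zero_state_no_adjacent_ones
      bij_betw_local_update_201_states no_adjacent_ones_subset) auto

lemma Lucas_group_eq:
  assumes k: "agrees_with_201 k" and n: "1 < n"
  shows "Lucas_group n = permutation_group_on (no_adjacent_ones n) (local_update n k ` {..<n})"
proof -
  have "(\<lambda>g. restrict g (no_adjacent_ones n)) ` carrier (G201 n)
      = carrier (permutation_group_on (no_adjacent_ones n) (local_update n 201 ` {..<n}))"
    unfolding G201_def
    using n bij_betw_local_update_201_states bij_betw_local_update[OF agrees_with_201_rules[of 201]]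
    by (intro carrier_permutation_group_on_restrict) (auto simp: no_adjacent_ones_subset)
  then have "Lucas_group n
      = permutation_group_on (no_adjacent_ones n) (local_update n 201 ` {..<n})"
    by (simp add: Lucas_group_def zero_orbit_eq[OF n] permutation_group_on_def)
  also have "\<dots> = permutation_group_on (no_adjacent_ones n) (local_update n k ` {..<n})"
    by (rule permutation_group_on_cong) (simp add: local_update_eq_201[OF k])
  finally show ?thesis .
qed


section \<open>Periodic states\<close>

lemma system_update_Cons:
  "system_update n k (i # \<pi>) y = system_update n k \<pi> (local_update n k i y)"
  by (simp add: system_update_def)

lemma system_update_append:
  "system_update n k (\<pi> @ \<rho>) y = system_update n k \<rho> (system_update n k \<pi> y)"
  by (simp add: system_update_def)

lemma bij_betw_system_update:
  assumes "\<And>i. i \<in> set \<pi> \<Longrightarrow> bij_betw (local_update n k i) T T"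
  shows "bij_betw (system_update n k \<pi>) T T"
  using assms
proof (induction \<pi>)
  case Nil
  then show ?case by (simp add: system_update_def id_def[symmetric])
next
  case (Cons i \<pi>)
  then have "bij_betw (system_update n k \<pi> \<circ> local_update n k i) T T"
    by (intro bij_betw_trans[of _ T T]) auto
  moreover have "system_update n k \<pi> \<circ> local_update n k i = system_update n k (i # \<pi>)"
    by (simp add: fun_eq_iff system_update_Cons)
  ultimately show ?case by simp
qed

lemma finite_bij_betw_periodic:
  assumes "finite T" "bij_betw f T T" "x \<in> T"
  shows "\<exists>m>0. (f ^^ m) x = x"
proof -
  have mem: "(f ^^ m) x \<in> T" for m
    by (induction m) (use assms in \<open>auto simp: bij_betw_def\<close>)
  have "range (\<lambda>m. (f ^^ m) x) \<subseteq> T"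
    using mem by blast
  then have "\<not> inj (\<lambda>m. (f ^^ m) x)"
    using finite_imageD[of "\<lambda>m. (f ^^ m) x" UNIV] finite_subset[OF _ assms(1)] infinite_UNIV_nat
    by blast
  then obtain c d where "c \<noteq> d" "(f ^^ c) x = (f ^^ d) x"
    by (auto simp: inj_def)
  then obtain a b where ab: "a < b" "(f ^^ a) x = (f ^^ b) x"
    by (cases c d rule: linorder_cases) auto
  then have "(f ^^ a) ((f ^^ (b - a)) x) = (f ^^ a) x"
    using funpow_add[of a "b - a" f] by simp
  moreover have "inj_on (f ^^ a) T"
    using bij_betw_funpow[OF assms(2)] by (simp add: bij_betw_def)
  ultimately have "(f ^^ (b - a)) x = x"
    using mem assms(3) by (simp add: inj_on_eq_iff)
  with ab(1) show ?thesis
    by (intro exI[of _ "b - a"]) simp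
qed

lemma no_adjacent_ones_periodic:
  assumes "agrees_with_201 k" "1 < n" "simple_update_order n \<pi>"
  shows "no_adjacent_ones n \<subseteq> periodic_states n k \<pi>"
proof
  fix y assume y: "y \<in> no_adjacent_ones n"
  have "bij_betw (system_update n k \<pi>) (no_adjacent_ones n) (no_adjacent_ones n)"
    using assms bij_betw_local_update
    by (intro bij_betw_system_update) (auto simp: simple_update_order_def)
  then show "y \<in> periodic_states n k \<pi>"
    using finite_bij_betw_periodic[OF finite_subset[OF no_adjacent_ones_subset finite_states] _ y]
      subsetD[OF no_adjacent_ones_subset y]
    by (simp add: periodic_states_def)
qed

definition adjacent_ones :: "nat \<Rightarrow> (nat \<Rightarrow> bit) \<Rightarrow> nat set" where
  "adjacent_ones n y = {i. i < n \<and> y i = 1 \<and> y (next_vertex n i) = 1}"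

text \<open>
  A vertex is only switched on between two zeros, so no new pair of adjacent ones
  ever arises.
\<close>

lemma adjacent_ones_local_update:
  assumes "agrees_with_201 k" "1 < n" "i < n"
  shows "adjacent_ones n (local_update n k i y) \<subseteq> adjacent_ones n y"
proof
  fix j assume j: "j \<in> adjacent_ones n (local_update n k i y)"
  then have jn: "j < n" by (simp add: adjacent_ones_def)
  have on: "y (prev_vertex n i) = 0 \<and> y (next_vertex n i) = 0"
    if "y i = 0" "local_update n k i y i = 1"
    using that assms(1) by (auto simp: local_update_def agrees_with_201_def split: if_splits)
  consider "j = i" | "next_vertex n j = i" "j \<noteq> i" | "j \<noteq> i" "next_vertex n j \<noteq> i"
    by blast
  then show "j \<in> adjacent_ones n y"
  proof cases
    case 1
    then show ?thesis
      using j on next_vertex_neq[OF assms(2,3)] bit_cases[of "y i"]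
      by (auto simp: adjacent_ones_def local_update_def)
  next
    case 2
    then show ?thesis
      using j on prev_vertex_next_vertex[OF jn] bit_cases[of "y i"]
      by (auto simp: adjacent_ones_def local_update_def)
  next
    case 3
    then show ?thesis
      using j by (auto simp: adjacent_ones_def local_update_def)
  qed
qed

lemma adjacent_ones_system_update:
  assumes "agrees_with_201 k" "1 < n" "set \<pi> \<subseteq> {..<n}"
  shows "adjacent_ones n (system_update n k \<pi> y) \<subseteq> adjacent_ones n y"
  using assms(3)
proof (induction \<pi> arbitrary: y)
  case Nil
  then show ?case by (simp add: system_update_def)
next
  case (Cons i \<pi>)
  then show ?case
    using adjacent_ones_local_update[OF assms(1,2), of i y]
    by (fastforce simp: system_update_Cons)
qed

lemma adjacent_ones_partial_sweep:
  assumes "agrees_with_201 k" "1 < n" "set (\<rho> @ \<sigma>) \<subseteq> {..<n}"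
    and "adjacent_ones n (system_update n k (\<rho> @ \<sigma>) y) = adjacent_ones n y"
  shows "adjacent_ones n (system_update n k \<rho> y) = adjacent_ones n y"
  using adjacent_ones_system_update[OF assms(1,2), of \<rho> y]
    adjacent_ones_system_update[OF assms(1,2), of \<sigma> "system_update n k \<rho> y"] assms(3,4)
  by (auto simp: system_update_append)

text \<open>A decreasing set that returns to its initial value has been constant.\<close>

lemma adjacent_ones_periodic:
  assumes "agrees_with_201 k" "1 < n" "set \<pi> \<subseteq> {..<n}" "y \<in> periodic_states n k \<pi>"
  shows "adjacent_ones n (system_update n k \<pi> y) = adjacent_ones n y"
proof -
  obtain m where m: "m > 0" "(system_update n k \<pi> ^^ m) y = y"
    using assms(4) by (auto simp: periodic_states_def)
  have decr: "adjacent_ones n ((system_update n k \<pi> ^^ l) z) \<subseteq> adjacent_ones n z" for l z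
  proof (induction l)
    case (Suc l)
    then show ?case
      using adjacent_ones_system_update[OF assms(1-3), of "(system_update n k \<pi> ^^ l) z"]
      by simp
  qed simp
  have "(system_update n k \<pi> ^^ (m - 1)) (system_update n k \<pi> y) = y"
    using m by (metis Suc_diff_1 funpow_Suc_right comp_apply)
  then show ?thesis
    using decr[of "m - 1" "system_update n k \<pi> y"] adjacent_ones_system_update[OF assms(1-3), of y]
    by auto
qed

text \<open>
  Let \<open>i\<close> be the last one of a block of at least two ones.  While the pair that it
  forms with its predecessor survives, \<open>i\<close> stays one and so its successor stays zero; hence the
  neighbourhood of \<open>i\<close> is \<open>110\<close> when the sweep comes to \<open>i\<close>, and the pair is destroyed
  there.  So in a state whose pairs survive, every pair is followed by another one.
\<close>

lemma adjacent_ones_next: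
  assumes k: "agrees_with_201 k" "wolfram k 1 1 0 = 0" and n: "1 < n"
    and \<pi>: "set \<pi> = {..<n}"
    and const: "adjacent_ones n (system_update n k \<pi> y) = adjacent_ones n y"
    and p: "p \<in> adjacent_ones n y"
  shows "next_vertex n p \<in> adjacent_ones n y"
proof (rule ccontr)
  define i where "i = next_vertex n p"
  assume "next_vertex n p \<notin> adjacent_ones n y"
  have pn: "p < n" and i: "i < n" and pi: "prev_vertex n i = p" and yi: "y i = 1"
    using p n by (auto simp: i_def adjacent_ones_def next_vertex_less prev_vertex_next_vertex)
  have y_next: "y (next_vertex n i) = 0"
    using \<open>next_vertex n p \<notin> adjacent_ones n y\<close> i yi bit_cases
    unfolding i_def[symmetric] by (auto simp: adjacent_ones_def)
  obtain \<rho> \<sigma> where split: "\<pi> = \<rho> @ i # \<sigma>"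
    using \<pi> i by (metis lessThan_iff split_list)
  have survives: "p \<in> adjacent_ones n (system_update n k \<alpha> y)" if "\<pi> = \<alpha> @ \<beta>" for \<alpha> \<beta>
    using adjacent_ones_partial_sweep[OF k(1) n, of \<alpha> \<beta> y] const \<pi> p that by auto
  have next_zero: "system_update n k \<alpha> y (next_vertex n i) = 0" if "\<pi> = \<alpha> @ \<beta>" for \<alpha> \<beta>
    using that
  proof (induction \<alpha> arbitrary: \<beta> rule: rev_induct)
    case Nil
    then show ?case using y_next by (simp add: system_update_def)
  next
    case (snoc j \<alpha>)
    define z where "z = system_update n k \<alpha> y"
    have "z (next_vertex n i) = 0"
      using snoc.IH[of "j # \<beta>"] snoc.prems by (simp add: z_def)
    moreover have "z i = 1"
      using survives[of \<alpha> "j # \<beta>"] snoc.prems by (simp add: adjacent_ones_def i_def z_def)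
    ultimately have "local_update n k j z (next_vertex n i) = 0"
      using k(1) prev_vertex_next_vertex[OF i] by (auto simp: local_update_def agrees_with_201_def)
    then show ?case
      by (simp add: system_update_append system_update_Cons z_def system_update_def)
  qed
  define z where "z = system_update n k \<rho> y"
  have "z p = 1" "z i = 1"
    using survives[OF split] by (simp_all add: adjacent_ones_def z_def i_def)
  moreover have "z (next_vertex n i) = 0"
    using next_zero[OF split] by (simp add: z_def)
  ultimately have "local_update n k i z i = 0"
    using k(2) pi by (simp add: local_update_def)
  moreover have "p \<in> adjacent_ones n (local_update n k i z)"
    using survives[of "\<rho> @ [i]" \<sigma>] split
    by (simp add: system_update_append z_def system_update_def)
  ultimately show False
    by (simp add: adjacent_ones_def i_def)
qed

lemma next_vertex_closed:
  assumes p: "p \<in> D" "p < n" and closed: "\<And>i. i \<in> D \<Longrightarrow> next_vertex n i \<in> D"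
  shows "{..<n} \<subseteq> D"
proof
  fix j assume j: "j \<in> {..<n}"
  have "(p + m) mod n \<in> D" for m
  proof (induction m)
    case 0
    then show ?case using p by simp
  next
    case (Suc m)
    then show ?case using closed[OF Suc] by (simp add: next_vertex_def mod_Suc_eq)
  qed
  from this[of "n - p + j"] show "j \<in> D"
    using p j by simp
qed

lemma periodic_no_adjacent_ones_or_one_state:
  assumes k: "agrees_with_201 k" "wolfram k 1 1 0 = 0" and n: "1 < n"
    and \<pi>: "simple_update_order n \<pi>"
    and y: "y \<in> periodic_states n k \<pi>" "y \<notin> no_adjacent_ones n"
  shows "y = one_state n" and "wolfram k 1 1 1 = 1"
proof -
  have set_\<pi>: "set \<pi> = {..<n}"
    using \<pi> by (simp add: simple_update_order_def)
  have const: "adjacent_ones n (system_update n k \<pi> y) = adjacent_ones n y"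
    using adjacent_ones_periodic[OF k(1) n _ y(1)] set_\<pi> by simp
  have ys: "y \<in> states n"
    using y(1) by (simp add: periodic_states_def)
  obtain p where p: "p \<in> adjacent_ones n y"
    using y(2) ys by (auto simp: no_adjacent_ones_def adjacent_ones_def)
  then have "p < n"
    by (simp add: adjacent_ones_def)
  have all: "{..<n} \<subseteq> adjacent_ones n y"
    using next_vertex_closed[OF p \<open>p < n\<close> adjacent_ones_next[OF k n set_\<pi> const]] .
  then have ones: "y i = 1" if "i < n" for i
    using that by (auto simp: adjacent_ones_def)
  then show "y = one_state n"
    using ys by (intro extensionalityI[of _ "{..<n}"]) (auto simp: states_def one_state_def PiE_def)
  \<comment> \<open>The first vertex of the sweep sees the neighbourhood \<open>111\<close>, and must not switch off.\<close>
  have "0 \<in> set \<pi>" using set_\<pi> n by simp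
  then obtain i \<rho> where i\<rho>: "\<pi> = i # \<rho>" by (cases \<pi>) auto
  then have i: "i < n" and \<rho>: "set \<rho> \<subseteq> {..<n}" using set_\<pi> by auto
  have "adjacent_ones n (local_update n k i y) = adjacent_ones n y"
    using adjacent_ones_partial_sweep[OF k(1) n, of "[i]" \<rho> y] const i\<rho> i \<rho>
    by (simp add: system_update_def)
  then have "local_update n k i y i = 1"
    using all i by (auto simp: adjacent_ones_def)
  then show "wolfram k 1 1 1 = 1"
    using ones i by (simp add: local_update_def next_vertex_less prev_vertex_less)
qed

lemma local_update_one_state:
  assumes "wolfram k 1 1 1 = 1" "i < n"
  shows "local_update n k i (one_state n) = one_state n"
  using assms by (auto simp: local_update_def one_state_def next_vertex_less prev_vertex_less)

lemma periodic_states_eq: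
  assumes k: "agrees_with_201 k" "wolfram k 1 1 0 = 0" and n: "1 < n"
    and \<pi>: "simple_update_order n \<pi>"
  shows "periodic_states n k \<pi> =
    no_adjacent_ones n \<union> (if wolfram k 1 1 1 = 1 then {one_state n} else {})"
proof -
  have "one_state n \<in> periodic_states n k \<pi>" if "wolfram k 1 1 1 = 1"
  proof -
    have "system_update n k \<rho> (one_state n) = one_state n" if "set \<rho> \<subseteq> {..<n}" for \<rho>
      using that local_update_one_state[OF \<open>wolfram k 1 1 1 = 1\<close>]
      by (induction \<rho>) (auto simp: system_update_def)
    then show ?thesis
      using \<pi> one_state_states
      by (auto simp: periodic_states_def simple_update_order_def intro: exI[of _ 1])
  qed
  moreover have "y \<in> no_adjacent_ones n \<or> y = one_state n \<and> wolfram k 1 1 1 = 1"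
    if "y \<in> periodic_states n k \<pi>" for y
    using periodic_no_adjacent_ones_or_one_state[OF k n \<pi> that] by blast
  ultimately show ?thesis
    using no_adjacent_ones_periodic[OF k(1) n \<pi>] by (auto split: if_splits)
qed


section \<open>The dynamics groups\<close>

lemma dynamics_without_one_state:
  assumes k: "agrees_with_201 k" "wolfram k 1 1 0 = 0" "wolfram k 1 1 1 = 0" and n: "1 < n"
    and \<pi>: "simple_update_order n \<pi>"
  shows "periodic_states n k \<pi> = no_adjacent_ones n"
    and "number_of_orbits n k \<pi> = 1" and "dynamics_group n k \<pi> \<cong> Lucas_group n"
proof -
  show P: "periodic_states n k \<pi> = no_adjacent_ones n"
    using periodic_states_eq[OF k(1,2) n \<pi>] k(3) by simp
  have G: "dynamics_group n k \<pi>
      = permutation_group_on (no_adjacent_ones n) (local_update n k ` {..<n})"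
    by (simp add: dynamics_group_def P)
  have "orbits (dynamics_group n k \<pi>) (periodic_states n k \<pi>) (\<lambda>g. g) = {no_adjacent_ones n}"
    using orbit_eq_no_adjacent_ones[OF k(1) n order_refl _ bij_betw_local_update[OF k(1) n]]
      zero_state_no_adjacent_ones[of n]
    by (auto simp: G P orbits_def)
  then show "number_of_orbits n k \<pi> = 1"
    by (simp add: number_of_orbits_def)
  show "dynamics_group n k \<pi> \<cong> Lucas_group n"
    by (simp add: G Lucas_group_eq[OF k(1) n] iso_refl)
qed

lemma dynamics_with_one_state:
  assumes k: "agrees_with_201 k" "wolfram k 1 1 0 = 0" "wolfram k 1 1 1 = 1" and n: "1 < n"
    and \<pi>: "simple_update_order n \<pi>"
  shows "periodic_states n k \<pi> = no_adjacent_ones n \<union> {one_state n}"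
    and "number_of_orbits n k \<pi> = 2" and "dynamics_group n k \<pi> \<cong> Lucas_group n"
proof -
  define S where "S = no_adjacent_ones n \<union> {one_state n}"
  define A where "A = local_update n k ` {..<n}"
  have P: "periodic_states n k \<pi> = S"
    using periodic_states_eq[OF k(1,2) n \<pi>] k(3) by (simp add: S_def)
  then show "periodic_states n k \<pi> = no_adjacent_ones n \<union> {one_state n}"
    by (simp only: S_def)
  have G: "dynamics_group n k \<pi> = permutation_group_on S A"
    by (simp add: dynamics_group_def P A_def)
  have notin: "one_state n \<notin> no_adjacent_ones n"
    using one_state_notin_no_adjacent_ones n by simp
  have bijN: "bij_betw f (no_adjacent_ones n) (no_adjacent_ones n)" if "f \<in> A" for f
    using that bij_betw_local_update[OF k(1) n] by (auto simp: A_def)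
  have fixed: "f (one_state n) = one_state n" if "f \<in> A" for f
    using that local_update_one_state[OF k(3)] by (auto simp: A_def)
  then have bij1: "bij_betw f {one_state n} {one_state n}" if "f \<in> A" for f
    using that by (simp add: bij_betw_def)
  have bijS: "bij_betw f S S" if "f \<in> A" for f
    unfolding S_def using bijN[OF that] bij1[OF that] notin by (intro bij_betw_combine) auto
  have "orbit (permutation_group_on S A) (\<lambda>g. g) x = no_adjacent_ones n"
    if "x \<in> no_adjacent_ones n" for x
    unfolding A_def
    using that bijS by (intro orbit_eq_no_adjacent_ones[OF k(1) n]) (auto simp: S_def A_def)
  moreover have "orbit (permutation_group_on S A) (\<lambda>g. g) (one_state n) = {one_state n}"
    using orbit_permutation_group_on_subset[of "{one_state n}" S "one_state n" A] bijS bij1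
      orbit_permutation_group_on_refl[of "one_state n" S A]
    by (auto simp: S_def)
  ultimately have "orbits (dynamics_group n k \<pi>) (periodic_states n k \<pi>) (\<lambda>g. g)
      = {no_adjacent_ones n, {one_state n}}"
    using zero_state_no_adjacent_ones[of n]
    by (auto simp: G P orbits_def S_def)
  moreover have "no_adjacent_ones n \<noteq> {one_state n}"
    using notin by blast
  ultimately show "number_of_orbits n k \<pi> = 2"
    by (simp add: number_of_orbits_def)
  have "permutation_group_on S A \<cong> permutation_group_on (no_adjacent_ones n) A"
    by (rule permutation_group_on_iso_restrict) (use bijS bijN fixed in \<open>auto simp: S_def\<close>)
  then show "dynamics_group n k \<pi> \<cong> Lucas_group n"
    by (simp add: G Lucas_group_eq[OF k(1) n] A_def)
qed

theorem mainTheorem10: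
  fixes n :: nat and \<pi> :: "nat list"
  assumes "n > 3" and "simple_update_order n \<pi>"
  shows "periodic_states n 1 \<pi> = no_adjacent_ones n
       \<and> periodic_states n 9 \<pi> = no_adjacent_ones n
       \<and> periodic_states n 129 \<pi> = no_adjacent_ones n \<union> {one_state n}
       \<and> periodic_states n 137 \<pi> = no_adjacent_ones n \<union> {one_state n}
       \<and> number_of_orbits n 1 \<pi> = 1
       \<and> number_of_orbits n 9 \<pi> = 1
       \<and> number_of_orbits n 129 \<pi> = 2
       \<and> number_of_orbits n 137 \<pi> = 2
       \<and> dynamics_group n 1 \<pi> \<cong> Lucas_group n
       \<and> dynamics_group n 9 \<pi> \<cong> Lucas_group n
       \<and> dynamics_group n 129 \<pi> \<cong> Lucas_group n
       \<and> dynamics_group n 137 \<pi> \<cong> Lucas_group n"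
proof -
  have n: "1 < n"
    using assms(1) by simp
  have k: "agrees_with_201 1" "agrees_with_201 9" "agrees_with_201 129" "agrees_with_201 137"
    by (simp_all add: agrees_with_201_rules)
  have e: "wolfram 1 1 1 0 = 0" "wolfram 9 1 1 0 = 0" "wolfram 129 1 1 0 = 0" "wolfram 137 1 1 0 = 0"
    by (simp_all add: wolfram_110)
  note without_one = dynamics_without_one_state[OF _ _ _ n assms(2)]
  note with_one = dynamics_with_one_state[OF _ _ _ n assms(2)]
  show ?thesis
    using without_one[OF k(1) e(1) wolfram_111(1)] without_one[OF k(2) e(2) wolfram_111(2)]
      with_one[OF k(3) e(3) wolfram_111(3)] with_one[OF k(4) e(4) wolfram_111(4)]
    by (intro conjI)
qed

end
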